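(* The language $\mathcal{NF}\subseteq\{a,a^{-1},t,t^{-1}\}^*$ of normal form words for the Baumslag-Solitar group $BS(1,2)=\langle a,t\mid tat^{-1}=a^2\rangle$ (defined in the context) is a 1-counter language.
   Context: **1-counter languages.** Let $\Sigma$ be a finite alphabet. A (non-deterministic) $\mathbb Z$-automaton over $\Sigma$ is a finite directed graph with a start vertex, some accept vertices, and edges labelled by elements of $(\Sigma\cup\{\epsilon\})\times\mathbb Z$, where $\epsilon$ is the empty word. It accepts a word $w\in\Sigma^*$ if there is a path from the start vertex to some accept vertex whose first label components concatenate to $w$ and whose second components sum to $0$ (the counter is only tested at the end). A language is 1-counter if it is the set of words accepted by some $\mathbb Z$-automaton. **Normal forms.** Words are over $\{a,a^{-1},t,t^{-1}\}$. The $t$-exponent of a word is the sum of the exponents of its $t^{\pm1}$ letters. An $N$-run is a word $a^{\epsilon_l}t^{-1}a^{\epsilon_{l-1}}t^{-1}\cdots t^{-1}a^{\epsilon_0}$, recorded by its sequence of entries $\epsilon_l\epsilon_{l-1}\cdots\epsilon_0$; a $P$-run is a word $a^{\epsilon_0}ta^{\epsilon_1}t\cdots ta^{\epsilon_l}$, recorded as $\epsilon_0\epsilon_1\cdots\epsilon_l$ (all $\epsilon_i\in\mathbb Z$). "The negative" of a sequence negates all of its entries. When several entries in a list carry $\pm$, all independent sign choices are allowed. The language $\mathcal{NF}$ is the union of the following five families of words. (1) $\epsilon, a^{\pm1},a^{\pm2},a^{\pm3}$. (2) (types $X$, $XN$, $XNP$; zero or negative $t$-exponent) Words $t^{k}a^{\epsilon_l}t^{-1}a^{\epsilon_{l-1}}t^{-1}\cdots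 a^{\epsilon_1}t^{-1}a^{\epsilon_0}t^{m}$ with $k>0$, $m\ge0$, $l\ge k+m$, and $\epsilon_0\ne0$ if $m>0$. If $l\ge3$: the $N$-run starts with one of $200,201,210,300,301,30(-1),310$ or the negative of one of these; all later entries are in $\{0,1,-1\}$; and no two consecutive entries are both nonzero, except possibly within the three-entry prefix. If $l\le2$: the word is in $L_1$, the set of words - $ta^it^{-1}a^j$, $ij=(\pm2)0,(\pm3)0,21,31,(-2)(-1),(-3)(-1)$; - $ta^it^{-1}a^jt^{-1}a^k$ and $t^2a^it^{-1}a^jt^{-1}a^k$, $ijk=(\pm2)00,(\pm3)00,201,(\pm3)01,(-2)0(-1),(\pm3)0(-1),210,310,(-2)(-1)0,(-3)(-1)0$; - $ta^it^{-1}a^jt^{-1}a^kt$, $ijk=201,(\pm3)01,(-2)0(-1),(\pm3)0(-1)$. (3) (types $N$, $NP_\le$; $t$-exponent $\le0$) Words $a^{\epsilon_l}t^{-1}a^{\epsilon_{l-1}}t^{-1}\cdots a^{\epsilon_1}t^{-1}a^{\epsilon_0}t^{k}$ with $0\le k\le l$, and $\epsilon_0\neq0$ if $k>0$. If $l\ge3$: the $N$-run starts with one of $000,001,010,100,101,10(-1),110,200,201,20(-1),210,300,301,30(-1),310$ or the negative of one of these; all later entries are in $\{0,1,-1\}$; and no two consecutive entries are both nonzero, except possibly within the three-entry prefix. If $l\le 2$: the word is in $L_2$, the set of words - $a^it^{-1}a^j$, $ij=00,(\pm1)0,(\pm2)0,(\pm3)0,0(\pm1),0(\pm2),0(\pm3),11,21,31,(-1)(-1),(-2)(-1),(-3)(-1)$;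 - $a^it^{-1}a^jt$, $ij=0(\pm1),0(\pm2),0(\pm3),11,21,31,(-1)(-1),(-2)(-1),(-3)(-1)$; - $a^it^{-1}a^jt^{-1}a^k$, $ijk=000,(\pm1)00,(\pm2)00,(\pm3)00,0(\pm1)0,0(\pm2)0,0(\pm3)0,00(\pm1),00(\pm2),00(\pm3),(\pm1)0(\pm1),(\pm2)0(\pm1),(\pm3)0(\pm1),110,210,310,(-1)(-1)0,(-2)(-1)0,(-3)(-1)0$; - $a^it^{-1}a^jt^{-1}a^kt$ and $a^it^{-1}a^jt^{-1}a^kt^2$, $ijk=00(\pm1),00(\pm2),00(\pm3),(\pm1)0(\pm1),(\pm2)0(\pm1),(\pm3)0(\pm1)$. (4) (types $P$, $NP_>$; positive $t$-exponent) Words $t^{-k}a^{\epsilon_0}ta^{\epsilon_1}t\cdots a^{\epsilon_{l-1}}ta^{\epsilon_l}$ with $0\le k<l$ and $\epsilon_0\ne0$ if $k>0$. If $l\ge3$: the $P$-run ends with one of $000,100,010,001,101,(-1)01,011,002,102,(-1)02,012,003,103,(-1)03,013$ or the negative of one of these; all earlier entries are in $\{0,1,-1\}$; and no two consecutive entries are both nonzero, except possibly within the three-entry suffix. If $l\le2$: the word (still subject to $0\le k<l$) is in $L_3$, the set of words - $a^ita^j$, $ij=00,0(\pm1),0(\pm2),0(\pm3),(\pm1)0,11,12,13,(-1)(-1),(-1)(-2),(-1)(-3)$; - $t^{-1}a^ita^j$, $ij=(\pm1)0,11,12,13,(-1)(-1),(-1)(-2),(-1)(-3)$; - $a^ita^jta^k$,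 $ijk=000,00(\pm1),00(\pm2),00(\pm3),(\pm1)0(\pm1),(\pm1)0(\pm2),(\pm1)0(\pm3),0(\pm1)0,011,012,013,0(-1)(-1),0(-1)(-2),0(-1)(-3)$; - $t^{-1}a^ita^jta^k$ and $t^{-2}a^ita^jta^k$, $ijk=(\pm1)0(\pm1),(\pm1)0(\pm2),(\pm1)0(\pm3)$. (5) (types $PX$, $NPX$; positive $t$-exponent) Words $t^{-k}a^{\epsilon_0}ta^{\epsilon_1}t\cdots a^{\epsilon_{l-1}}ta^{\epsilon_l}t^{-m}$ with $k\ge0$, $m>0$, $k+m<l$, and $\epsilon_0\neq0$ if $k>0$. If $l\ge3$: the $P$-run ends with one of $002,102,012,003,103,(-1)03,013$ or the negative of one of these; all earlier entries are in $\{0,1,-1\}$; and no two consecutive entries are both nonzero, except possibly within the three-entry suffix. If $l=2$: the word is in $L_4$, the set of words - $a^ita^jta^kt^{-1}$, $ijk=00(\pm2),00(\pm3),012,013,0(-1)(-2),0(-1)(-3),102,10(\pm3),(-1)0(-2),(-1)0(\pm3)$. *)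

theory Defs
  imports Main
begin

section \<open>1-counter languages\<close>

record ('v, 's) zaut =
  verts :: "'v set"
  start :: 'v
  accepting :: "'v set"
  edges :: "('v \<times> ('s option \<times> int) \<times> 'v) set"

text \<open>The label \<open>None\<close> stands for the empty word.\<close>

fun label_word :: "'s option \<Rightarrow> 's list" where
  "label_word None = []"
| "label_word (Some s) = [s]"

definition z_automaton :: "('v, 's::finite) zaut \<Rightarrow> bool" where
  "z_automaton M \<longleftrightarrow>
     finite (verts M) \<and> start M \<in> verts M \<and> accepting M \<subseteq> verts M \<and>
     finite (edges M) \<and> edges M \<subseteq> verts M \<times> UNIV \<times> verts M"

inductive zpath :: "('v, 's) zaut \<Rightarrow> 'v \<Rightarrow> 's list \<Rightarrow> int \<Rightarrow> 'v \<Rightarrow> bool"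
  for M :: "('v, 's) zaut" where
  zpath_empty: "u \<in> verts M \<Longrightarrow> zpath M u [] 0 u"
| zpath_step: "(u, (x, n), v) \<in> edges M \<Longrightarrow> zpath M v w c v' \<Longrightarrow>
                 zpath M u (label_word x @ w) (n + c) v'"

definition zaut_language :: "('v, 's) zaut \<Rightarrow> 's list set" where
  "zaut_language M = {w. \<exists>v \<in> accepting M. zpath M (start M) w 0 v}"

text \<open>Vertices are taken to be natural numbers, because a definition cannot quantify over
  the vertex type. The lemma \<open>one_counter_language_any_vertices\<close> below shows that
  nothing is lost.\<close>

definition one_counter_language :: "'s::finite list set \<Rightarrow> bool" where
  "one_counter_language L \<longleftrightarrow>
     (\<exists>M :: (nat, 's) zaut. z_automaton M \<and> zaut_language M = L)"

definition rename_zaut :: "('v \<Rightarrow> 'u) \<Rightarrow> ('v, 's) zaut \<Rightarrow> ('u, 's) zaut" where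
  "rename_zaut f M = \<lparr>verts = f ` verts M, start = f (start M), accepting = f ` accepting M,
     edges = (\<lambda>(u, x, v). (f u, x, f v)) ` edges M\<rparr>"

lemma zpath_rename: "zpath M u w c v \<Longrightarrow> zpath (rename_zaut f M) (f u) w c (f v)"
proof (induction rule: zpath.induct)
  case (zpath_empty u)
  then show ?case by (auto intro: zpath.zpath_empty simp: rename_zaut_def)
next
  case (zpath_step u x n v w c v')
  have "(f u, (x, n), f v) \<in> edges (rename_zaut f M)"
    using zpath_step.hyps(1) by (force simp: rename_zaut_def)
  then show ?case using zpath_step.IH by (rule zpath.zpath_step)
qed

lemma zpath_unrename:
  assumes M: "z_automaton M" and inj: "inj_on f (verts M)"
    and "zpath (rename_zaut f M) p w c q"
  shows "\<exists>u \<in> verts M. \<exists>v \<in> verts M. p = f u \<and> q = f v \<and> zpath M u w c v"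
  using assms(3)
proof (induction rule: zpath.induct)
  case (zpath_empty p)
  then show ?case by (auto intro: zpath.zpath_empty simp: rename_zaut_def)
next
  case (zpath_step p x n q w c q')
  then obtain u v where uv: "p = f u" "q = f v" "(u, (x, n), v) \<in> edges M"
    by (auto simp: rename_zaut_def)
  with M have mem: "u \<in> verts M" "v \<in> verts M"
    by (auto simp: z_automaton_def)
  from zpath_step.IH obtain v0 v' where
    "v0 \<in> verts M" "v' \<in> verts M" "q = f v0" "q' = f v'" "zpath M v0 w c v'" by blast
  with uv mem inj have "zpath M v w c v'" by (auto dest: inj_onD)
  with uv(3) have "zpath M u (label_word x @ w) (n + c) v'" by (rule zpath.zpath_step)
  with uv mem \<open>v' \<in> verts M\<close> \<open>q' = f v'\<close> show ?case by blast
qed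

lemma one_counter_language_any_vertices:
  fixes M :: "('v, 's::finite) zaut"
  assumes M: "z_automaton M"
  shows "one_counter_language (zaut_language M)"
proof -
  from M have "finite (verts M)" by (simp add: z_automaton_def)
  then obtain f :: "'v \<Rightarrow> nat" where inj: "inj_on f (verts M)"
    using finite_imp_inj_to_nat_seg by blast
  have "z_automaton (rename_zaut f M)"
    using M by (fastforce simp: z_automaton_def rename_zaut_def)
  moreover have "zaut_language (rename_zaut f M) = zaut_language M"
  proof (intro set_eqI iffI)
    fix w assume "w \<in> zaut_language M"
    then obtain v where "v \<in> accepting M" "zpath M (start M) w 0 v"
      by (auto simp: zaut_language_def)
    then show "w \<in> zaut_language (rename_zaut f M)"
      using zpath_rename[of M "start M" w 0 v f]
      by (auto simp: zaut_language_def rename_zaut_def)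
  next
    fix w assume "w \<in> zaut_language (rename_zaut f M)"
    then obtain v where v: "v \<in> accepting M" "zpath (rename_zaut f M) (f (start M)) w 0 (f v)"
      by (auto simp: zaut_language_def rename_zaut_def)
    from zpath_unrename[OF M inj v(2)] obtain u' v' where
      "u' \<in> verts M" "v' \<in> verts M" "f (start M) = f u'" "f v = f v'" "zpath M u' w 0 v'"
      by blast
    moreover have "start M \<in> verts M" "v \<in> verts M"
      using M v(1) by (auto simp: z_automaton_def)
    ultimately have "zpath M (start M) w 0 v" using inj by (metis inj_onD)
    with v(1) show "w \<in> zaut_language M" by (auto simp: zaut_language_def)
  qed
  ultimately show ?thesis unfolding one_counter_language_def by blast
qed


section \<open>Words, runs and entry sequences\<close>

datatype letter = gen_a | gen_a_inv | gen_t | gen_t_inv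

instance letter :: finite
proof
  have "(UNIV :: letter set) = {gen_a, gen_a_inv, gen_t, gen_t_inv}"
    using letter.exhaust by auto
  then show "finite (UNIV :: letter set)" by (metis finite.emptyI finite_insert)
qed

type_synonym word = "letter list"

definition a_pow :: "int \<Rightarrow> word" where
  "a_pow n = (if 0 \<le> n then replicate (nat n) gen_a else replicate (nat (- n)) gen_a_inv)"

definition t_pow :: "int \<Rightarrow> word" where
  "t_pow n = (if 0 \<le> n then replicate (nat n) gen_t else replicate (nat (- n)) gen_t_inv)"

text \<open>A run with \<open>l\<close> separators has \<open>l + 1\<close> entries, listed in the order in
  which they occur in the word. So \<open>\<epsilon>\<^sub>0\<close> is the last entry of an
  \<open>N\<close>-run and the first entry of a \<open>P\<close>-run.\<close>

fun run :: "letter \<Rightarrow> int list \<Rightarrow> word" where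
  "run s [] = []"
| "run s [e] = a_pow e"
| "run s (e # e' # es) = a_pow e @ s # run s (e' # es)"

abbreviation N_run :: "int list \<Rightarrow> word" where
  "N_run \<equiv> run gen_t_inv"

abbreviation P_run :: "int list \<Rightarrow> word" where
  "P_run \<equiv> run gen_t"

text \<open>Below, \<open>listset\<close> expands entry sequences carrying independent signs:
  for instance \<open>listset [pm 1, {0}, pm 3]\<close> is the set of the four sequences abbreviated
  by \<open>(\<plusminus>1)0(\<plusminus>3)\<close>.\<close>

definition pm :: "int \<Rightarrow> int set" where
  "pm n = {n, - n}"

definition with_negatives :: "int list set \<Rightarrow> int list set" where
  "with_negatives S = S \<union> map uminus ` S"

definition N_admissible :: "int list set \<Rightarrow> int list \<Rightarrow> bool" where
  "N_admissible S es \<longleftrightarrow>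
     take 3 es \<in> with_negatives S \<and>
     set (drop 3 es) \<subseteq> {0, 1, -1} \<and>
     (\<forall>i. 2 \<le> i \<and> i + 1 < length es \<longrightarrow> es ! i = 0 \<or> es ! (i + 1) = 0)"

definition P_admissible :: "int list set \<Rightarrow> int list \<Rightarrow> bool" where
  "P_admissible S es \<longleftrightarrow>
     drop (length es - 3) es \<in> with_negatives S \<and>
     set (take (length es - 3) es) \<subseteq> {0, 1, -1} \<and>
     (\<forall>i. i + 3 < length es \<longrightarrow> es ! i = 0 \<or> es ! (i + 1) = 0)"


section \<open>The normal forms\<close>

definition L1 :: "word set" where
  "L1 =
     {t_pow 1 @ N_run es | es. es \<in>
        listset [pm 2, {0}] \<union> listset [pm 3, {0}] \<union> {[2,1], [3,1], [-2,-1], [-3,-1]}} \<union>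
     {t_pow k @ N_run es | k es. k \<in> {1, 2} \<and> es \<in>
        listset [pm 2, {0}, {0}] \<union> listset [pm 3, {0}, {0}] \<union> {[2,0,1]} \<union>
        listset [pm 3, {0}, {1}] \<union> {[-2,0,-1]} \<union> listset [pm 3, {0}, {-1}] \<union>
        {[2,1,0], [3,1,0], [-2,-1,0], [-3,-1,0]}} \<union>
     {t_pow 1 @ N_run es @ t_pow 1 | es. es \<in>
        {[2,0,1]} \<union> listset [pm 3, {0}, {1}] \<union> {[-2,0,-1]} \<union> listset [pm 3, {0}, {-1}]}"

definition L2 :: "word set" where
  "L2 =
     {N_run es | es. es \<in>
        {[0,0]} \<union> listset [pm 1, {0}] \<union> listset [pm 2, {0}] \<union> listset [pm 3, {0}] \<union>
        listset [{0}, pm 1] \<union> listset [{0}, pm 2] \<union> listset [{0}, pm 3] \<union>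
        {[1,1], [2,1], [3,1], [-1,-1], [-2,-1], [-3,-1]}} \<union>
     {N_run es @ t_pow 1 | es. es \<in>
        listset [{0}, pm 1] \<union> listset [{0}, pm 2] \<union> listset [{0}, pm 3] \<union>
        {[1,1], [2,1], [3,1], [-1,-1], [-2,-1], [-3,-1]}} \<union>
     {N_run es | es. es \<in>
        {[0,0,0]} \<union>
        listset [pm 1, {0}, {0}] \<union> listset [pm 2, {0}, {0}] \<union> listset [pm 3, {0}, {0}] \<union>
        listset [{0}, pm 1, {0}] \<union> listset [{0}, pm 2, {0}] \<union> listset [{0}, pm 3, {0}] \<union>
        listset [{0}, {0}, pm 1] \<union> listset [{0}, {0}, pm 2] \<union> listset [{0}, {0}, pm 3] \<union>
        listset [pm 1, {0}, pm 1] \<union> listset [pm 2, {0}, pm 1] \<union> listset [pm 3, {0}, pm 1] \<union>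
        {[1,1,0], [2,1,0], [3,1,0], [-1,-1,0], [-2,-1,0], [-3,-1,0]}} \<union>
     {N_run es @ t_pow k | es k. k \<in> {1, 2} \<and> es \<in>
        listset [{0}, {0}, pm 1] \<union> listset [{0}, {0}, pm 2] \<union> listset [{0}, {0}, pm 3] \<union>
        listset [pm 1, {0}, pm 1] \<union> listset [pm 2, {0}, pm 1] \<union> listset [pm 3, {0}, pm 1]}"

definition L3 :: "word set" where
  "L3 =
     {P_run es | es. es \<in>
        {[0,0]} \<union> listset [{0}, pm 1] \<union> listset [{0}, pm 2] \<union> listset [{0}, pm 3] \<union>
        listset [pm 1, {0}] \<union> {[1,1], [1,2], [1,3], [-1,-1], [-1,-2], [-1,-3]}} \<union>
     {t_pow (-1) @ P_run es | es. es \<in>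
        listset [pm 1, {0}] \<union> {[1,1], [1,2], [1,3], [-1,-1], [-1,-2], [-1,-3]}} \<union>
     {P_run es | es. es \<in>
        {[0,0,0]} \<union>
        listset [{0}, {0}, pm 1] \<union> listset [{0}, {0}, pm 2] \<union> listset [{0}, {0}, pm 3] \<union>
        listset [pm 1, {0}, pm 1] \<union> listset [pm 1, {0}, pm 2] \<union> listset [pm 1, {0}, pm 3] \<union>
        listset [{0}, pm 1, {0}] \<union>
        {[0,1,1], [0,1,2], [0,1,3], [0,-1,-1], [0,-1,-2], [0,-1,-3]}} \<union>
     {t_pow (- k) @ P_run es | k es. k \<in> {1, 2} \<and> es \<in>
        listset [pm 1, {0}, pm 1] \<union> listset [pm 1, {0}, pm 2] \<union> listset [pm 1, {0}, pm 3]}"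

definition L4 :: "word set" where
  "L4 =
     {P_run es @ t_pow (-1) | es. es \<in>
        listset [{0}, {0}, pm 2] \<union> listset [{0}, {0}, pm 3] \<union>
        {[0,1,2], [0,1,3], [0,-1,-2], [0,-1,-3], [1,0,2]} \<union> listset [{1}, {0}, pm 3] \<union>
        {[-1,0,-2]} \<union> listset [{-1}, {0}, pm 3]}"

definition NF1 :: "word set" where
  "NF1 = a_pow ` ({0} \<union> pm 1 \<union> pm 2 \<union> pm 3)"

definition NF2 :: "word set" where
  "NF2 = {w. \<exists>(k::nat) (m::nat) l es.
     w = t_pow (int k) @ N_run es @ t_pow (int m) \<and> length es = l + 1 \<and>
     0 < k \<and> k + m \<le> l \<and> (0 < m \<longrightarrow> last es \<noteq> 0) \<and>
     (if 3 \<le> l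
      then N_admissible
             {[2,0,0], [2,0,1], [2,1,0], [3,0,0], [3,0,1], [3,0,-1], [3,1,0]} es
      else w \<in> L1)}"

definition NF3 :: "word set" where
  "NF3 = {w. \<exists>(k::nat) l es.
     w = N_run es @ t_pow (int k) \<and> length es = l + 1 \<and>
     k \<le> l \<and> (0 < k \<longrightarrow> last es \<noteq> 0) \<and>
     (if 3 \<le> l
      then N_admissible
             {[0,0,0], [0,0,1], [0,1,0], [1,0,0], [1,0,1], [1,0,-1], [1,1,0],
              [2,0,0], [2,0,1], [2,0,-1], [2,1,0], [3,0,0], [3,0,1], [3,0,-1], [3,1,0]} es
      else w \<in> L2)}"

text \<open>The bound \<open>k < l\<close> also applies when \<open>l \<le> 2\<close>, where it excludes those
  words of \<open>L3\<close> whose \<open>t\<close>-exponent is 0.\<close>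

definition NF4 :: "word set" where
  "NF4 = {w. \<exists>(k::nat) l es.
     w = t_pow (- int k) @ P_run es \<and> length es = l + 1 \<and>
     k < l \<and> (0 < k \<longrightarrow> hd es \<noteq> 0) \<and>
     (if 3 \<le> l
      then P_admissible
             {[0,0,0], [1,0,0], [0,1,0], [0,0,1], [1,0,1], [-1,0,1], [0,1,1],
              [0,0,2], [1,0,2], [-1,0,2], [0,1,2], [0,0,3], [1,0,3], [-1,0,3], [0,1,3]} es
      else w \<in> L3)}"

definition NF5 :: "word set" where
  "NF5 = {w. \<exists>(k::nat) (m::nat) l es.
     w = t_pow (- int k) @ P_run es @ t_pow (- int m) \<and> length es = l + 1 \<and>
     0 < m \<and> k + m < l \<and> (0 < k \<longrightarrow> hd es \<noteq> 0) \<and>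
     (if 3 \<le> l
      then P_admissible
             {[0,0,2], [1,0,2], [0,1,2], [0,0,3], [1,0,3], [-1,0,3], [0,1,3]} es
      else w \<in> L4)}"

definition NF :: "word set" where
  "NF = NF1 \<union> NF2 \<union> NF3 \<union> NF4 \<union> NF5"

end

theory Submission
  imports Defs
begin

text \<open>Apart from finitely many words, the normal forms make up four families, and in each of
  them, up to reversal, a word consists of a power of some letter \<open>u\<close>, a run with separator
  \<open>u\<inverse>\<close>, and another power of \<open>u\<close>. The conditions on the entries of the run (a prefix from a
  finite list, then entries in \<open>{0, 1, -1}\<close> of which no two neighbours are both nonzero, and a
  nonzero last entry if the closing power is nontrivial) are local, so a finite automaton can
  check them. The only comparison of unbounded quantities is that the lengths of the two powers
  must add up to at most (in two families, less than) the number of separators. One counter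
  suffices for it: every \<open>u\<close> adds 1, every separator subtracts 1 (the strict bound adds a
  further 1), and a loop labelled by the empty word adds 1 arbitrarily often, so that the counter
  can end at 0 exactly when the number of separators is large enough. This is
  \<open>one_counter_language_padded_runs\<close>.

  The remaining ingredients are formal. The \<open>P\<close>-runs are constrained at their right end and not
  at their left end; reversing all words turns them into the same kind of family, with the
  letters \<open>t\<close> and \<open>t\<inverse>\<close> exchanged, and 1-counter languages are closed under reversal
  (\<open>one_counter_language_rev\<close>). They are closed under union
  (\<open>one_counter_language_Un\<close>), which puts the families and the finitely many short words
  together (\<open>NF2_split\<close> to \<open>NF5_split\<close>).

  All automata are built with edges that read whole words, and with sets of start
  vertices; spelling out the labels letter by letter
  (\<open>one_counter_language_wlang\<close>) turns them into \<open>\<int>\<close>-automata.\<close>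

section \<open>Automata with word labels\<close>

inductive wpath :: "('v \<times> ('s list \<times> int) \<times> 'v) set \<Rightarrow> 'v \<Rightarrow> 's list \<Rightarrow> int \<Rightarrow> 'v \<Rightarrow> bool"
  for E where
  wpath_empty: "wpath E u [] 0 u"
| wpath_step: "(u, (x, n), v) \<in> E \<Longrightarrow> wpath E v w c v' \<Longrightarrow> wpath E u (x @ w) (n + c) v'"

definition wlang :: "('v \<times> ('s list \<times> int) \<times> 'v) set \<Rightarrow> 'v set \<Rightarrow> 'v set \<Rightarrow> 's list set" where
  "wlang E I F = {w. \<exists>p \<in> I. \<exists>q \<in> F. wpath E p w 0 q}"

lemma wpath_edge: "(u, (x, n), v) \<in> E \<Longrightarrow> wpath E u x n v"
  using wpath_step[OF _ wpath_empty, of u x n v E] by simp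

lemma wpath_append:
  assumes "wpath E u w c v" "wpath E v w' c' v'"
  shows "wpath E u (w @ w') (c + c') v'"
  using assms
proof (induction rule: wpath.induct)
  case (wpath_step u x n v w c v0)
  from wpath.wpath_step[OF wpath_step.hyps(1) wpath_step.IH[OF wpath_step.prems]]
  show ?case by (simp add: add.assoc)
qed simp

lemma wpath_loop:
  assumes "(u, (x, n), u) \<in> E"
  shows "wpath E u (concat (replicate k x)) (int k * n) u"
proof (induction k)
  case 0
  show ?case by (simp add: wpath_empty)
next
  case (Suc k)
  from wpath_step[OF assms Suc] show ?case by (simp add: algebra_simps)
qed

definition suffixes_of_labels :: "('v \<times> ('s list \<times> int) \<times> 'v) set \<Rightarrow> 's list set" where
  "suffixes_of_labels E = insert [] (\<Union>(_, (x, _), _) \<in> E. (\<lambda>k. drop k x) ` {..length x})"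

definition vertices_of :: "('v \<times> ('s list \<times> int) \<times> 'v) set \<Rightarrow> 'v set" where
  "vertices_of E = (\<Union>(p, _, q) \<in> E. {p, q})"

text \<open>A vertex \<open>Some (q, x)\<close> promises that \<open>x\<close> will be read next and that \<open>q\<close>
  is reached afterwards. An edge of \<open>E\<close> makes such a promise and pays its whole weight at
  once; the letters of \<open>x\<close> are then consumed at weight 0. As only suffixes of labels can be
  outstanding, finitely many vertices suffice. The vertex \<open>None\<close> is a single start vertex that
  leads to all of \<open>I\<close>.\<close>

definition spell_out ::
  "('v \<times> ('s list \<times> int) \<times> 'v) set \<Rightarrow> 'v set \<Rightarrow> 'v set \<Rightarrow> (('v \<times> 's list) option, 's) zaut" where
  "spell_out E I F = \<lparr>
     verts = insert None (Some ` ((vertices_of E \<union> I \<union> F) \<times> suffixes_of_labels E)),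
     start = None,
     accepting = (\<lambda>q. Some (q, [])) ` F,
     edges = (\<lambda>p. (None, (None, 0), Some (p, []))) ` I \<union>
       (\<lambda>(p, (x, n), q). (Some (p, []), (None, n), Some (q, x))) ` E \<union>
       (\<lambda>(q, y). (Some (q, y), (Some (hd y), 0), Some (q, tl y))) `
         ((vertices_of E \<union> I \<union> F) \<times> (suffixes_of_labels E - {[]}))\<rparr>"

lemma Nil_in_suffixes: "[] \<in> suffixes_of_labels E"
  by (simp add: suffixes_of_labels_def)

lemma label_in_suffixes:
  assumes "(p, (x, n), q) \<in> E" shows "x \<in> suffixes_of_labels E"
proof -
  have "x \<in> (\<lambda>k. drop k x) ` {..length x}" by (rule image_eqI[of _ _ 0]) auto
  then show ?thesis unfolding suffixes_of_labels_def using assms by fast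
qed

lemma tl_in_suffixes:
  assumes "y \<in> suffixes_of_labels E" shows "tl y \<in> suffixes_of_labels E"
proof (cases y)
  case (Cons s z)
  with assms obtain p x n q k where e: "(p, (x, n), q) \<in> E" "y = drop k x" "k \<le> length x"
    by (auto simp: suffixes_of_labels_def)
  with Cons have "tl y = drop (Suc k) x" "Suc k \<le> length x"
    by (auto simp: drop_Suc tl_drop[symmetric] Suc_le_eq order_less_le)
  then have "tl y \<in> (\<lambda>k. drop k x) ` {..length x}" by auto
  then show ?thesis unfolding suffixes_of_labels_def using e by fast
qed (simp add: suffixes_of_labels_def)

lemma finite_suffixes: "finite E \<Longrightarrow> finite (suffixes_of_labels E)"
  by (auto simp: suffixes_of_labels_def)

lemma finite_vertices_of: "finite E \<Longrightarrow> finite (vertices_of E)"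
  by (auto simp: vertices_of_def)

lemma vertices_of_edge: "(p, y, q) \<in> E \<Longrightarrow> p \<in> vertices_of E \<and> q \<in> vertices_of E"
  by (force simp: vertices_of_def)

lemma z_automaton_spell_out:
  fixes E :: "('v \<times> ('s::finite list \<times> int) \<times> 'v) set"
  assumes "finite E" "finite I" "finite F"
  shows "z_automaton (spell_out E I F)"
  using assms
  by (auto simp: z_automaton_def spell_out_def finite_suffixes finite_vertices_of
      Nil_in_suffixes tl_in_suffixes dest: vertices_of_edge label_in_suffixes)

text \<open>The paths of interest start with nothing outstanding, but they pass through vertices where
  a word \<open>x\<close> still has to be read, so the induction has to allow for it.\<close>

lemma spell_out_sound:
  assumes "zpath (spell_out E I F) (Some (q, x)) w c (Some (q', []))"
  shows "\<exists>w'. w = x @ w' \<and> wpath E q w' c q'"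
  using assms
proof (induction "Some (q, x)" w c "Some (q', [] :: 'b list)" arbitrary: q x rule: zpath.induct)
  case zpath_empty
  then show ?case by (simp add: wpath_empty)
next
  case (zpath_step y n v w c)
  from zpath_step.hyps(1) consider
      (edge) x' q1 where "x = []" "y = None" "v = Some (q1, x')" "(q, (x', n), q1) \<in> E"
    | (letter) "x \<noteq> []" "y = Some (hd x)" "n = 0" "v = Some (q, tl x)"
    by (auto simp: spell_out_def)
  then show ?case
  proof cases
    case edge
    with zpath_step.hyps(3) show ?thesis by (auto intro: wpath_step)
  next
    case letter
    with zpath_step.hyps(3)[of q "tl x"] show ?thesis by (cases x) auto
  qed
qed

lemma spell_out_enter_edge:
  "p \<in> I \<Longrightarrow> (None, (None, 0), Some (p, [])) \<in> edges (spell_out E I F)"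
  unfolding spell_out_def zaut.select_convs by (rule UnI1, rule UnI1, rule imageI)

lemma spell_out_promise_edge:
  "(p, (x, n), q) \<in> E \<Longrightarrow> (Some (p, []), (None, n), Some (q, x)) \<in> edges (spell_out E I F)"
  unfolding spell_out_def zaut.select_convs
  by (rule UnI1, rule UnI2, rule image_eqI[of _ _ "(p, (x, n), q)"]) simp_all

lemma spell_out_letter_edge:
  "s # x \<in> suffixes_of_labels E \<Longrightarrow> q \<in> vertices_of E \<union> I \<union> F \<Longrightarrow>
    (Some (q, s # x), (Some s, 0), Some (q, x)) \<in> edges (spell_out E I F)"
  unfolding spell_out_def zaut.select_convs
  by (rule UnI2, rule image_eqI[of _ _ "(q, s # x)"]) simp_all

lemma spell_out_letters:
  assumes "x \<in> suffixes_of_labels E" "q \<in> vertices_of E \<union> I \<union> F"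
    and "zpath (spell_out E I F) (Some (q, [])) w c v"
  shows "zpath (spell_out E I F) (Some (q, x)) (x @ w) c v"
  using assms(1)
proof (induction x)
  case (Cons s x)
  from tl_in_suffixes[OF Cons.prems] have "x \<in> suffixes_of_labels E" by simp
  then have "zpath (spell_out E I F) (Some (q, x)) (x @ w) c v" by (rule Cons.IH)
  moreover have "(Some (q, s # x), (Some s, 0), Some (q, x)) \<in> edges (spell_out E I F)"
    using Cons.prems assms(2) by (rule spell_out_letter_edge)
  ultimately have "zpath (spell_out E I F) (Some (q, s # x)) (label_word (Some s) @ x @ w) (0 + c) v"
    by (intro zpath.zpath_step)
  then show ?case by simp
qed (use assms in simp)

lemma spell_out_complete:
  assumes "wpath E p w c q" "p \<in> vertices_of E \<union> I \<union> F"
  shows "zpath (spell_out E I F) (Some (p, [])) w c (Some (q, []))"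
  using assms
proof (induction rule: wpath.induct)
  case (wpath_empty u)
  then show ?case
    by (intro zpath.zpath_empty) (auto simp: spell_out_def Nil_in_suffixes)
next
  case (wpath_step u x n v w c v')
  have v: "v \<in> vertices_of E \<union> I \<union> F" using vertices_of_edge[OF wpath_step.hyps(1)] by blast
  have "zpath (spell_out E I F) (Some (v, x)) (x @ w) c (Some (v', []))"
    using spell_out_letters[OF label_in_suffixes[OF wpath_step.hyps(1)] v wpath_step.IH[OF v]] .
  moreover have "(Some (u, []), (None, n), Some (v, x)) \<in> edges (spell_out E I F)"
    using wpath_step.hyps(1) by (rule spell_out_promise_edge)
  ultimately have "zpath (spell_out E I F) (Some (u, [])) (label_word None @ x @ w) (n + c)
      (Some (v', []))"
    by (intro zpath.zpath_step)
  then show ?case by simp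
qed

text \<open>Word labels, and sets of start vertices, do not increase the expressive power.\<close>

lemma one_counter_language_wlang:
  fixes E :: "('v \<times> ('s::finite list \<times> int) \<times> 'v) set"
  assumes "finite E" "finite I" "finite F"
  shows "one_counter_language (wlang E I F)"
proof -
  have "zaut_language (spell_out E I F) = wlang E I F"
  proof (intro set_eqI iffI)
    fix w assume "w \<in> zaut_language (spell_out E I F)"
    then obtain q where q: "q \<in> F" "zpath (spell_out E I F) None w 0 (Some (q, []))"
      by (auto simp: zaut_language_def spell_out_def)
    from q(2) obtain p where "p \<in> I" "zpath (spell_out E I F) (Some (p, [])) w 0 (Some (q, []))"
      by cases (auto simp: spell_out_def)
    moreover from spell_out_sound[OF this(2)] have "wpath E p w 0 q" by simp
    ultimately show "w \<in> wlang E I F" using q(1) by (auto simp: wlang_def)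
  next
    fix w assume "w \<in> wlang E I F"
    then obtain p q where pq: "p \<in> I" "q \<in> F" "wpath E p w 0 q" by (auto simp: wlang_def)
    then have "zpath (spell_out E I F) (Some (p, [])) w 0 (Some (q, []))"
      by (intro spell_out_complete) auto
    moreover have "(None, (None, 0), Some (p, [])) \<in> edges (spell_out E I F)"
      using pq(1) by (rule spell_out_enter_edge)
    ultimately have "zpath (spell_out E I F) None (label_word None @ w) (0 + 0) (Some (q, []))"
      by (intro zpath.zpath_step)
    then have "zpath (spell_out E I F) None w 0 (Some (q, []))" by simp
    with pq(2) show "w \<in> zaut_language (spell_out E I F)"
      by (auto simp: zaut_language_def spell_out_def)
  qed
  then show ?thesis
    using one_counter_language_any_vertices[OF z_automaton_spell_out[OF assms]] by simp
qed

text \<open>The converse: closure properties need only be proved for word-labelled automata, which are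
  easier to build.\<close>

lemma one_counter_language_obtain_wlang:
  fixes L :: "'s::finite list set"
  assumes "one_counter_language L"
  obtains E :: "(nat \<times> ('s list \<times> int) \<times> nat) set" and I F
  where "finite E" "finite I" "finite F" "L = wlang E I F"
proof -
  from assms obtain M :: "(nat, 's) zaut" where M: "z_automaton M" "zaut_language M = L"
    by (auto simp: one_counter_language_def)
  define E where "E = (\<lambda>(u, (x, n), v). (u, (label_word x, n), v)) ` edges M"
  have sound: "wpath E u w c v" if "zpath M u w c v" for u w c v
    using that
  proof (induction rule: zpath.induct)
    case (zpath_step u x n v w c v')
    have "(u, (label_word x, n), v) \<in> E"
      unfolding E_def by (rule image_eqI[OF _ zpath_step.hyps(1)]) simp
    then show ?case using zpath_step.IH by (rule wpath.wpath_step)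
  qed (rule wpath_empty)
  have complete: "zpath M u w c v" if "wpath E u w c v" "v \<in> verts M" for u w c v
    using that
  proof (induction rule: wpath.induct)
    case (wpath_step u x n v w c v')
    then show ?case by (auto simp: E_def intro: zpath.zpath_step)
  qed (rule zpath.zpath_empty)
  have "accepting M \<subseteq> verts M" using M(1) by (simp add: z_automaton_def)
  then have "L = wlang E {start M} (accepting M)"
    unfolding M(2)[symmetric] zaut_language_def wlang_def using sound complete by blast
  moreover have "finite E" using M(1) by (simp add: E_def z_automaton_def)
  moreover have "finite (accepting M)" using M(1) finite_subset by (auto simp: z_automaton_def)
  ultimately show ?thesis using that[of E "{start M}" "accepting M"] by simp
qed

section \<open>Closure properties\<close>

text \<open>The disjoint union of two automata works because no path leads from one part to the
  other, and because several start vertices are available.\<close>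

lemma one_counter_language_Un:
  fixes L K :: "'s::finite list set"
  assumes "one_counter_language L" "one_counter_language K"
  shows "one_counter_language (L \<union> K)"
proof -
  obtain E1 :: "(nat \<times> ('s list \<times> int) \<times> nat) set" and I1 F1
    where 1: "finite E1" "finite I1" "finite F1" "L = wlang E1 I1 F1"
    using one_counter_language_obtain_wlang[OF assms(1)] by blast
  obtain E2 :: "(nat \<times> ('s list \<times> int) \<times> nat) set" and I2 F2
    where 2: "finite E2" "finite I2" "finite F2" "K = wlang E2 I2 F2"
    using one_counter_language_obtain_wlang[OF assms(2)] by blast
  define E :: "((nat + nat) \<times> ('s list \<times> int) \<times> (nat + nat)) set" where
    "E = (\<lambda>(u, y, v). (Inl u, y, Inl v)) ` E1 \<union> (\<lambda>(u, y, v). (Inr u, y, Inr v)) ` E2"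
  have to1: "wpath E1 u w c v" if "wpath E (Inl u) w c (Inl v)" for u w c v
    using that
    by (induction "Inl u :: nat + nat" w c "Inl v :: nat + nat" arbitrary: u rule: wpath.induct)
      (auto simp: E_def intro: wpath.intros)
  have to2: "wpath E2 u w c v" if "wpath E (Inr u) w c (Inr v)" for u w c v
    using that
    by (induction "Inr u :: nat + nat" w c "Inr v :: nat + nat" arbitrary: u rule: wpath.induct)
      (auto simp: E_def intro: wpath.intros)
  have stay: "isl p = isl q" if "wpath E p w c q" for p w c q
    using that by (induction rule: wpath.induct) (auto simp: E_def)
  have from1: "wpath E (Inl u) w c (Inl v)" if "wpath E1 u w c v" for u w c v
    using that by (induction rule: wpath.induct) (force simp: E_def intro: wpath.intros)+
  have from2: "wpath E (Inr u) w c (Inr v)" if "wpath E2 u w c v" for u w c v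
    using that by (induction rule: wpath.induct) (force simp: E_def intro: wpath.intros)+
  have "L \<union> K = wlang E (Inl ` I1 \<union> Inr ` I2) (Inl ` F1 \<union> Inr ` F2)"
  proof (intro set_eqI iffI)
    fix w assume "w \<in> L \<union> K"
    then show "w \<in> wlang E (Inl ` I1 \<union> Inr ` I2) (Inl ` F1 \<union> Inr ` F2)"
      unfolding 1 2 wlang_def using from1 from2 by blast
  next
    fix w assume "w \<in> wlang E (Inl ` I1 \<union> Inr ` I2) (Inl ` F1 \<union> Inr ` F2)"
    then obtain p q where pq: "p \<in> Inl ` I1 \<union> Inr ` I2" "q \<in> Inl ` F1 \<union> Inr ` F2" "wpath E p w 0 q"
      unfolding wlang_def by blast
    with stay[OF pq(3)] show "w \<in> L \<union> K"
      unfolding 1 2 wlang_def by (auto dest: to1 to2)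
  qed
  moreover have "finite E" using 1 2 by (simp add: E_def)
  ultimately show ?thesis using 1 2 by (simp add: one_counter_language_wlang)
qed

text \<open>Reverse all edges and their labels, and exchange start and accepting vertices; the sum of the
  weights does not depend on the order.\<close>

lemma one_counter_language_rev:
  fixes L :: "'s::finite list set"
  assumes "one_counter_language L"
  shows "one_counter_language (rev ` L)"
proof -
  obtain E :: "(nat \<times> ('s list \<times> int) \<times> nat) set" and I F
    where E: "finite E" "finite I" "finite F" "L = wlang E I F"
    using one_counter_language_obtain_wlang[OF assms] by blast
  define R :: "(nat \<times> ('s list \<times> int) \<times> nat) set \<Rightarrow> (nat \<times> ('s list \<times> int) \<times> nat) set"
    where "R = (`) (\<lambda>(u, (x, n), v). (v, (rev x, n), u))"
  have R: "wpath (R D) v (rev w) c u" if "wpath D u w c v" for D u w c v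
    using that
  proof (induction rule: wpath.induct)
    case (wpath_step u x n v w c v')
    then have "wpath (R D) v (rev x) n u" by (force simp: R_def intro: wpath_edge)
    from wpath_append[OF wpath_step.IH this] show ?case by (simp add: add.commute)
  qed (simp add: wpath_empty)
  have RR: "R (R E) = E" by (force simp: R_def image_image)
  have "rev ` L = wlang (R E) F I"
  proof (intro set_eqI iffI)
    fix w assume "w \<in> wlang (R E) F I"
    then obtain p q where "p \<in> F" "q \<in> I" "wpath (R E) p w 0 q" by (auto simp: wlang_def)
    then have "rev w \<in> L" using R[of "R E" p w 0 q] by (auto simp: E RR wlang_def)
    then show "w \<in> rev ` L" by (metis imageI rev_rev_ident)
  next
    fix w assume "w \<in> rev ` L"
    then obtain v p q where "w = rev v" "p \<in> I" "q \<in> F" "wpath E p v 0 q"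
      by (auto simp: E wlang_def)
    with R[of E p v 0 q] show "w \<in> wlang (R E) F I" by (auto simp: wlang_def)
  qed
  moreover have "finite (R E)" using E by (simp add: R_def)
  ultimately show ?thesis using E by (simp add: one_counter_language_wlang)
qed

lemma one_counter_language_finite:
  fixes L :: "'s::finite list set"
  assumes "finite L"
  shows "one_counter_language L"
proof -
  define E where "E = (\<lambda>w :: 's list. (False, (w, 0 :: int), True)) ` L"
  have True_end: "w = []" if "wpath E True w c q" for w c q
    using that by cases (auto simp: E_def)
  have "L = wlang E {False} {True}"
  proof (intro set_eqI iffI)
    fix w assume "w \<in> wlang E {False} {True}"
    then have "wpath E False w 0 True" by (simp add: wlang_def)
    then show "w \<in> L"
    proof cases
      case (wpath_step x n v w' c)
      then have "x \<in> L" "v = True" by (auto simp: E_def)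
      with wpath_step True_end[of w' c True] show ?thesis by simp
    qed simp
  qed (auto simp: wlang_def E_def intro: wpath_edge)
  moreover have "finite E" using assms by (simp add: E_def)
  ultimately show ?thesis by (simp add: one_counter_language_wlang)
qed

section \<open>Runs between powers of a letter\<close>

lemma run_append:
  "es \<noteq> [] \<Longrightarrow> run s (es @ fs) = run s es @ concat (map (\<lambda>x. s # a_pow x) fs)"
proof (induction s es rule: run.induct)
  case (2 s e)
  have "run s (e # fs) = a_pow e @ concat (map (\<lambda>x. s # a_pow x) fs)"
    by (induction fs arbitrary: e) simp_all
  then show ?case by simp
qed simp_all

lemma rev_a_pow: "rev (a_pow n) = a_pow n"
  by (simp add: a_pow_def)

lemma rev_run: "rev (run s es) = run s (rev es)"
proof (induction s es rule: run.induct)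
  case (3 s e e' es)
  have "run s (rev (e' # es) @ [e]) = run s (rev (e' # es)) @ s # a_pow e"
    by (subst run_append) simp_all
  with 3 show ?case by (simp add: rev_a_pow)
qed (simp_all add: rev_a_pow)

lemma successively_iff_nth:
  "successively P xs \<longleftrightarrow> (\<forall>i. Suc i < length xs \<longrightarrow> P (xs ! i) (xs ! Suc i))"
proof (induction P xs rule: successively.induct)
  case (3 P x y xs)
  then show ?case by (force simp: less_Suc_eq_0_disj nth_Cons split: nat.splits)
qed simp_all

text \<open>An admissible entry sequence in the form in which an automaton meets it: three entries
  from the finite list, a fourth one \<open>x\<close>, and further entries each of which is constrained only
  by its predecessor.\<close>

lemma N_admissible_iff:
  assumes "4 \<le> length es"
  shows "N_admissible S es \<longleftrightarrow> (\<exists>p x fs. es = p @ x # fs \<and> length p = 3 \<and>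
           p \<in> with_negatives S \<and> set (x # fs) \<subseteq> {0, 1, -1} \<and>
           successively (\<lambda>e e'. e = 0 \<or> e' = 0) (last p # x # fs))"
    (is "_ \<longleftrightarrow> ?R")
proof -
  from assms obtain a b c x fs where es: "es = [a, b, c] @ x # fs"
    by (auto simp: numeral_eq_Suc Suc_le_length_iff)
  have "(\<forall>i. 2 \<le> i \<and> i + 1 < length es \<longrightarrow> es ! i = 0 \<or> es ! (i + 1) = 0) \<longleftrightarrow>
      (\<forall>j. Suc j < length (drop 2 es) \<longrightarrow> drop 2 es ! j = 0 \<or> drop 2 es ! Suc j = 0)"
    (is "?A = ?B")
  proof
    assume ?A
    then show ?B using assms by (auto dest: spec[of _ "2 + _"])
  next
    assume B: ?B
    show ?A
    proof (intro allI impI)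
      fix i assume "2 \<le> i \<and> i + 1 < length es"
      moreover from this obtain j where "i = 2 + j" using le_Suc_ex by blast
      ultimately show "es ! i = 0 \<or> es ! (i + 1) = 0" using B[rule_format, of j] assms by simp
    qed
  qed
  also have "\<dots> \<longleftrightarrow> successively (\<lambda>e e'. e = 0 \<or> e' = 0) (c # x # fs)"
    by (simp add: successively_iff_nth es)
  finally have "N_admissible S es \<longleftrightarrow> [a, b, c] \<in> with_negatives S \<and> set (x # fs) \<subseteq> {0, 1, -1} \<and>
      successively (\<lambda>e e'. e = 0 \<or> e' = 0) (c # x # fs)"
    unfolding N_admissible_def by (simp add: es)
  also have "\<dots> \<longleftrightarrow> ?R"
  proof
    assume ?R
    then obtain p y gs where R: "es = p @ y # gs" "length p = 3" "p \<in> with_negatives S"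
      "set (y # gs) \<subseteq> {0, 1, -1}" "successively (\<lambda>e e'. e = 0 \<or> e' = 0) (last p # y # gs)"
      by blast
    have "p @ y # gs = [a, b, c] @ x # fs" using R(1) es by simp
    then have "p = [a, b, c]" "y # gs = x # fs" 
      using R(2) by (subst (asm) append_eq_append_conv; simp)+
    with R show "[a, b, c] \<in> with_negatives S \<and> set (x # fs) \<subseteq> {0, 1, -1} \<and>
      successively (\<lambda>e e'. e = 0 \<or> e' = 0) (c # x # fs)" by simp
  qed (use es in \<open>force intro: exI[of _ "[a, b, c]"]\<close>)
  finally show ?thesis .
qed

text \<open>The common shape of the four infinite families. Since a run has one separator less than it
  has entries, \<open>k + m + d < length es\<close> says that there are at least \<open>k + m + d\<close> separators; \<open>d\<close>
  is 1 where the powers of \<open>t\<close> must be strictly shorter than the run. The flag \<open>b\<close> decides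
  whether an initial power of \<open>u\<close> is obligatory or forbidden.\<close>

definition padded_runs :: "bool \<Rightarrow> nat \<Rightarrow> letter \<Rightarrow> letter \<Rightarrow> int list set \<Rightarrow> word set" where
  "padded_runs b d u s S = {replicate k u @ run s es @ replicate m u | k m es.
     (0 < k \<longleftrightarrow> b) \<and> 4 \<le> length es \<and> k + m + d < length es \<and> (0 < m \<longrightarrow> last es \<noteq> 0) \<and>
     N_admissible S es}"

text \<open>\<open>Lead\<close> is the stage in which the initial power is read, \<open>Entry e\<close> follows an entry \<open>e\<close>
  that is the fourth or a later one, and \<open>Trail\<close> follows at least one letter of the closing power.\<close>

datatype stage = Start | Lead | Entry int | Trail

text \<open>The counter holds the number of letters \<open>u\<close>, plus \<open>d\<close>, minus the number of separators, plus
  the number of uses of the edge \<open>slack\<close>. That edge may be used arbitrarily often, so it turns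
  the test for 0 at the end into an inequality. The first four entries are read by one
  edge, with three separators; this is also what forces the run to have at least four entries.
  A closing power can only be entered after a nonzero entry.\<close>

inductive_set run_edges ::
  "bool \<Rightarrow> nat \<Rightarrow> letter \<Rightarrow> letter \<Rightarrow> int list set \<Rightarrow> (stage \<times> (word \<times> int) \<times> stage) set"
  for b d u s S where
  start_pad: "b \<Longrightarrow> (Start, ([u], int d + 1), Lead) \<in> run_edges b d u s S"
| start: "\<not> b \<Longrightarrow> (Start, ([], int d), Lead) \<in> run_edges b d u s S"
| pad: "b \<Longrightarrow> (Lead, ([u], 1), Lead) \<in> run_edges b d u s S"
| slack: "(Lead, ([], 1), Lead) \<in> run_edges b d u s S"
| first: "p \<in> with_negatives S \<Longrightarrow> length p = 3 \<Longrightarrow> x \<in> {0, 1, -1} \<Longrightarrow> last p = 0 \<or> x = 0 \<Longrightarrow>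
    (Lead, (run s (p @ [x]), -3), Entry x) \<in> run_edges b d u s S"
| entry: "e \<in> {0, 1, -1} \<Longrightarrow> x \<in> {0, 1, -1} \<Longrightarrow> e = 0 \<or> x = 0 \<Longrightarrow>
    (Entry e, (s # a_pow x, -1), Entry x) \<in> run_edges b d u s S"
| stop: "e \<in> {1, -1} \<Longrightarrow> (Entry e, ([u], 1), Trail) \<in> run_edges b d u s S"
| trail: "(Trail, ([u], 1), Trail) \<in> run_edges b d u s S"

text \<open>The words and counter changes that lead from a stage to acceptance. At \<open>Lead\<close> and \<open>Start\<close>
  the counter change \<open>c\<close> is only bounded from below, because of the slack; from \<open>Entry e\<close> on
  no slack is available, and it is the exact balance of letters \<open>u\<close> and separators.\<close>

fun remainder :: "bool \<Rightarrow> nat \<Rightarrow> letter \<Rightarrow> letter \<Rightarrow> int list set \<Rightarrow> stage \<Rightarrow> word \<Rightarrow> int \<Rightarrow> bool" where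
  "remainder b d u s S Trail w c \<longleftrightarrow> (\<exists>m. w = replicate m u \<and> c = int m)"
| "remainder b d u s S (Entry e) w c \<longleftrightarrow> (\<exists>fs m.
     w = concat (map (\<lambda>x. s # a_pow x) fs) @ replicate m u \<and>
     c = int m - int (length fs) \<and> set (e # fs) \<subseteq> {0, 1, -1} \<and>
     successively (\<lambda>e e'. e = 0 \<or> e' = 0) (e # fs) \<and> (0 < m \<longrightarrow> last (e # fs) \<noteq> 0))"
| "remainder b d u s S Lead w c \<longleftrightarrow> (\<exists>k m es.
     w = replicate k u @ run s es @ replicate m u \<and> (0 < k \<longrightarrow> b) \<and> 4 \<le> length es \<and>
     int k + int m \<le> c + int (length es) - 1 \<and> (0 < m \<longrightarrow> last es \<noteq> 0) \<and> N_admissible S es)"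
| "remainder b d u s S Start w c \<longleftrightarrow> (\<exists>k m es.
     w = replicate k u @ run s es @ replicate m u \<and> (0 < k \<longleftrightarrow> b) \<and> 4 \<le> length es \<and>
     int k + int m + int d \<le> c + int (length es) - 1 \<and> (0 < m \<longrightarrow> last es \<noteq> 0) \<and> N_admissible S es)"


text \<open>The soundness of the automaton: \<open>remainder\<close> is closed under prepending an edge.\<close>

lemma remainder_step:
  assumes "(p, (x, n), q) \<in> run_edges b d u s S" "remainder b d u s S q w c"
  shows "remainder b d u s S p (x @ w) (n + c)"
proof -
  from assms(1) show ?thesis
  proof cases
    case start_pad
    with assms(2) obtain k m es where "w = replicate k u @ run s es @ replicate m u"
      "4 \<le> length es" "int k + int m \<le> c + int (length es) - 1" "0 < m \<longrightarrow> last es \<noteq> 0"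
      "N_admissible S es" by auto
    with start_pad show ?thesis
      by simp (intro exI[of _ "Suc k"] exI[of _ m] exI[of _ es], simp)
  next
    case start
    with assms(2) obtain k m es where "w = replicate k u @ run s es @ replicate m u" "k = 0"
      "4 \<le> length es" "int k + int m \<le> c + int (length es) - 1" "0 < m \<longrightarrow> last es \<noteq> 0"
      "N_admissible S es" by auto
    with start show ?thesis
      by simp (intro exI[of _ 0] exI[of _ m] exI[of _ es], simp)
  next
    case pad
    with assms(2) obtain k m es where "w = replicate k u @ run s es @ replicate m u"
      "4 \<le> length es" "int k + int m \<le> c + int (length es) - 1" "0 < m \<longrightarrow> last es \<noteq> 0"
      "N_admissible S es" by auto
    with pad show ?thesis
      by simp (intro exI[of _ "Suc k"] exI[of _ m] exI[of _ es], simp)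
  next
    case slack
    with assms(2) obtain k m es where "w = replicate k u @ run s es @ replicate m u" "0 < k \<longrightarrow> b"
      "4 \<le> length es" "int k + int m \<le> c + int (length es) - 1" "0 < m \<longrightarrow> last es \<noteq> 0"
      "N_admissible S es" by auto
    with slack show ?thesis
      by simp (intro exI[of _ k] exI[of _ m] exI[of _ es], simp)
  next
    case (first y f)
    with assms(2) obtain fs m where fs: "w = concat (map (\<lambda>x. s # a_pow x) fs) @ replicate m u"
      "c = int m - int (length fs)" "set (f # fs) \<subseteq> {0, 1, -1}"
      "successively (\<lambda>e e'. e = 0 \<or> e' = 0) (f # fs)" "0 < m \<longrightarrow> last (f # fs) \<noteq> 0"
      by auto
    have "x @ w = run s (y @ f # fs) @ replicate m u"
      using run_append[of "y @ [f]" s fs] first fs(1) by simp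
    moreover have "N_admissible S (y @ f # fs)"
      using first fs by (subst N_admissible_iff) (auto intro!: exI[of _ y])
    ultimately show ?thesis using first fs
      by simp (intro exI[of _ 0] exI[of _ m] exI[of _ "y @ f # fs"], simp)
  next
    case (entry e f)
    with assms(2) obtain fs m where fs: "w = concat (map (\<lambda>x. s # a_pow x) fs) @ replicate m u"
      "c = int m - int (length fs)" "set (f # fs) \<subseteq> {0, 1, -1}"
      "successively (\<lambda>e e'. e = 0 \<or> e' = 0) (f # fs)" "0 < m \<longrightarrow> last (f # fs) \<noteq> 0"
      by auto
    with entry show ?thesis
      by simp (intro exI[of _ "f # fs"] exI[of _ m], simp)
  next
    case (stop e)
    with assms(2) obtain m where "w = replicate m u" "c = int m" by auto
    with stop show ?thesis
      by (auto intro!: exI[of _ "[]"] exI[of _ "Suc m"])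
  next
    case trail
    with assms(2) obtain m where "w = replicate m u" "c = int m" by auto
    with trail show ?thesis by simp (intro exI[of _ "Suc m"], simp)
  qed
qed

lemma wpath_run_edges_sound:
  assumes "wpath (run_edges b d u s S) p w c q" "q \<in> {Entry 0, Entry 1, Entry (-1), Trail}"
  shows "remainder b d u s S p w c"
  using assms
proof (induction rule: wpath.induct)
  case (wpath_empty q)
  then show ?case by (auto intro: exI[of _ "[]"])
next
  case (wpath_step u x n v w c v')
  from remainder_step[OF wpath_step.hyps(1) wpath_step.IH[OF wpath_step.prems]] show ?case .
qed

lemma wpath_pad:
  assumes "(q, ([u], 1), q) \<in> E"
  shows "wpath E q (replicate k u) (int k) q"
proof -
  have "concat (replicate k [u]) = replicate k u" by (induction k) auto
  with wpath_loop[OF assms, of k] show ?thesis by simp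
qed

lemma wpath_from_Entry:
  assumes "set (e # fs) \<subseteq> {0, 1, -1}" "successively (\<lambda>e e'. e = 0 \<or> e' = 0) (e # fs)"
    "0 < m \<longrightarrow> last (e # fs) \<noteq> 0"
  shows "\<exists>q \<in> {Entry 0, Entry 1, Entry (-1), Trail}. wpath (run_edges b d u s S) (Entry e)
    (concat (map (\<lambda>x. s # a_pow x) fs) @ replicate m u) (int m - int (length fs)) q"
  using assms
proof (induction fs arbitrary: e)
  case Nil
  show ?case
  proof (cases m)
    case 0
    with Nil show ?thesis by (auto intro: wpath_empty)
  next
    case (Suc m')
    with Nil have "(Entry e, ([u], 1), Trail) \<in> run_edges b d u s S"
      by (intro stop) auto
    moreover have "wpath (run_edges b d u s S) Trail (replicate m' u) (int m') Trail"
      by (intro wpath_pad trail)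
    ultimately have "wpath (run_edges b d u s S) (Entry e) ([u] @ replicate m' u) (1 + int m') Trail"
      by (rule wpath_step)
    with Suc show ?thesis by simp
  qed
next
  case (Cons f fs)
  then obtain q where q: "q \<in> {Entry 0, Entry 1, Entry (-1), Trail}"
    "wpath (run_edges b d u s S) (Entry f) (concat (map (\<lambda>x. s # a_pow x) fs) @ replicate m u)
       (int m - int (length fs)) q"
    using Cons.IH[of f] by auto
  have "(Entry e, (s # a_pow f, -1), Entry f) \<in> run_edges b d u s S"
    using Cons.prems by (intro entry) auto
  from wpath_step[OF this q(2)] q(1) show ?case by (auto simp: algebra_simps)
qed

text \<open>The slack edge makes up the difference between the required counter change \<open>c\<close> and the
  balance of letters \<open>u\<close> and separators, which the third assumption makes nonnegative.\<close>

lemma wpath_from_Lead: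
  assumes "0 < k \<longrightarrow> b" "4 \<le> length es" "int k + int m \<le> c + int (length es) - 1"
    "0 < m \<longrightarrow> last es \<noteq> 0" "N_admissible S es"
  shows "\<exists>q \<in> {Entry 0, Entry 1, Entry (-1), Trail}. wpath (run_edges b d u s S) Lead
    (replicate k u @ run s es @ replicate m u) c q"
proof -
  let ?E = "run_edges b d u s S"
  from assms(2,5) obtain p x fs where es: "es = p @ x # fs" "length p = 3" "p \<in> with_negatives S"
    "set (x # fs) \<subseteq> {0, 1, -1}" "successively (\<lambda>e e'. e = 0 \<or> e' = 0) (last p # x # fs)"
    by (auto simp: N_admissible_iff)
  have "0 < m \<longrightarrow> last (x # fs) \<noteq> 0" using assms(4) es(1) by simp
  with es wpath_from_Entry[of x fs m b d u s S] obtain q where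
    q: "q \<in> {Entry 0, Entry 1, Entry (-1), Trail}"
    "wpath ?E (Entry x) (concat (map (\<lambda>x. s # a_pow x) fs) @ replicate m u)
       (int m - int (length fs)) q" by auto
  have "(Lead, (run s (p @ [x]), -3), Entry x) \<in> ?E"
    using es by (intro first) auto
  from wpath_step[OF this q(2)]
  have run: "wpath ?E Lead (run s es @ replicate m u) (int m + 1 - int (length es)) q"
    using run_append[of "p @ [x]" s fs] es(1,2) by (simp add: algebra_simps)
  have pad: "wpath ?E Lead (replicate k u) (int k) Lead"
  proof (cases "k = 0")
    case False
    with assms(1) show ?thesis by (intro wpath_pad pad) simp
  qed (simp add: wpath_empty)
  \<comment> \<open>the number of uses of the slack edge that balances the counter\<close>
  define j where "j = nat (c + int (length es) - 1 - int k - int m)"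
  have "wpath ?E Lead (concat (replicate j [])) (int j * 1) Lead"
    by (intro wpath_loop slack)
  then have "wpath ?E Lead [] (int j) Lead" by simp
  from wpath_append[OF wpath_append[OF pad this] run] q(1) assms(3) show ?thesis
    by (auto simp: j_def)
qed

lemma wlang_run_edges:
  "wlang (run_edges b d u s S) {Start} {Entry 0, Entry 1, Entry (-1), Trail} = padded_runs b d u s S"
proof (intro set_eqI iffI)
  fix w assume "w \<in> wlang (run_edges b d u s S) {Start} {Entry 0, Entry 1, Entry (-1), Trail}"
  then have "remainder b d u s S Start w 0"
    using wpath_run_edges_sound unfolding wlang_def by blast
  then obtain k m es where "w = replicate k u @ run s es @ replicate m u" "0 < k \<longleftrightarrow> b"
    "4 \<le> length es" "int k + int m + int d \<le> int (length es) - 1" "0 < m \<longrightarrow> last es \<noteq> 0"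
    "N_admissible S es" by auto
  then show "w \<in> padded_runs b d u s S"
    unfolding padded_runs_def by (intro CollectI exI[of _ k] exI[of _ m] exI[of _ es]) auto
next
  let ?E = "run_edges b d u s S"
  fix w assume "w \<in> padded_runs b d u s S"
  then obtain k m es where w: "w = replicate k u @ run s es @ replicate m u" "0 < k \<longleftrightarrow> b"
    "4 \<le> length es" "k + m + d < length es" "0 < m \<longrightarrow> last es \<noteq> 0" "N_admissible S es"
    unfolding padded_runs_def by blast
  have "\<exists>q \<in> {Entry 0, Entry 1, Entry (-1), Trail}. wpath ?E Start w 0 q"
  proof (cases k)
    case 0
    with w have edge: "(Start, ([], int d), Lead) \<in> ?E" by (intro start) simp
    from w 0 obtain q where "q \<in> {Entry 0, Entry 1, Entry (-1), Trail}" "wpath ?E Lead w (- int d) q"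
      using wpath_from_Lead[of 0 b es m "- int d" S d u s] by auto
    with wpath_step[OF edge, of w "- int d" q] show ?thesis by auto
  next
    case (Suc k')
    with w have edge: "(Start, ([u], int d + 1), Lead) \<in> ?E" by (intro start_pad) simp
    let ?v = "replicate k' u @ run s es @ replicate m u"
    from w Suc obtain q where "q \<in> {Entry 0, Entry 1, Entry (-1), Trail}"
      "wpath ?E Lead ?v (- int d - 1) q"
      using wpath_from_Lead[of k' b es m "- int d - 1" S d u s] by auto
    with wpath_step[OF edge, of ?v "- int d - 1" q] w(1) Suc show ?thesis by auto
  qed
  then show "w \<in> wlang ?E {Start} {Entry 0, Entry 1, Entry (-1), Trail}"
    by (auto simp: wlang_def)
qed

lemma finite_with_negatives: "finite S \<Longrightarrow> finite (with_negatives S)"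
  by (simp add: with_negatives_def)

lemma finite_run_edges:
  assumes "finite S" shows "finite (run_edges b d u s S)"
proof (rule finite_subset)
  define A where "A = {0, 1, -1 :: int}"
  define T0 where "T0 = {(Start, ([u], int d + 1), Lead), (Start, ([], int d), Lead),
    (Lead, ([u], 1), Lead), (Lead, ([], 1), Lead), (Trail, ([u], 1), Trail)}"
  define T1 where "T1 = {(Lead, (run s (p @ [x]), -3 :: int), Entry x) | p x.
    p \<in> with_negatives S \<and> x \<in> A}"
  define T2 where "T2 = {(Entry e, (s # a_pow x, -1 :: int), Entry x) | e x. e \<in> A \<and> x \<in> A}"
  define T3 where "T3 = {(Entry e, ([u], 1 :: int), Trail) | e. e \<in> A}"
  have "(p, (x, n), q) \<in> T0 \<union> T1 \<union> T2 \<union> T3" if "(p, (x, n), q) \<in> run_edges b d u s S" for p x n q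
    using that
  proof cases
    case (first y f)
    then have "(p, (x, n), q) \<in> T1" unfolding T1_def A_def[symmetric] by blast
    then show ?thesis by simp
  next
    case (entry e f)
    then have "(p, (x, n), q) \<in> T2" unfolding T2_def A_def[symmetric] by blast
    then show ?thesis by simp
  next
    case (stop e)
    then have "e \<in> A" by (auto simp: A_def)
    with stop have "(p, (x, n), q) \<in> T3" unfolding T3_def by blast
    then show ?thesis by simp
  qed (simp_all add: T0_def)
  then show "run_edges b d u s S \<subseteq> T0 \<union> T1 \<union> T2 \<union> T3" by (metis prod.exhaust subsetI)
  have "finite A" by (simp add: A_def)
  then have "finite T1" "finite T2" "finite T3"
    unfolding T1_def T2_def T3_def using assms
    by (intro finite_image_set2 finite_image_set; simp add: finite_with_negatives)+
  then show "finite (T0 \<union> T1 \<union> T2 \<union> T3)" by (simp add: T0_def)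
qed

lemma one_counter_language_padded_runs:
  assumes "finite S" shows "one_counter_language (padded_runs b d u s S)"
  unfolding wlang_run_edges[symmetric]
  by (rule one_counter_language_wlang) (simp_all add: finite_run_edges assms)

section \<open>Normal forms\<close>

lemma with_negatives_rev: "with_negatives (rev ` S) = rev ` with_negatives S"
  by (auto simp: with_negatives_def image_image image_Un rev_map)

text \<open>The constraint that spares the first two pairs of neighbours of an \<open>N\<close>-run spares the last two
  pairs of a \<open>P\<close>-run.\<close>

lemma N_admissible_rev: "N_admissible (rev ` S) (rev es) \<longleftrightarrow> P_admissible S es"
proof -
  have "(\<forall>i. 2 \<le> i \<and> i + 1 < length (rev es) \<longrightarrow> rev es ! i = 0 \<or> rev es ! (i + 1) = 0) \<longleftrightarrow>
      (\<forall>i. i + 3 < length es \<longrightarrow> es ! i = 0 \<or> es ! (i + 1) = 0)" (is "?A = ?B")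
  proof
    assume A: ?A
    show ?B
    proof (intro allI impI)
      fix i assume i: "i + 3 < length es"
      then obtain j where "length es = i + 3 + j" "0 < j" using less_imp_add_positive by metis
      with A[rule_format, of "Suc j"] show "es ! i = 0 \<or> es ! (i + 1) = 0"
        by (auto simp: rev_nth)
    qed
  next
    assume B: ?B
    show ?A
    proof (intro allI impI)
      fix i assume "2 \<le> i \<and> i + 1 < length (rev es)"
      moreover from this obtain j where "0 < j" "i + 1 + j = length es"
        using less_imp_add_positive[of "i + 1" "length es"] by auto
      ultimately have "length es = i + 1 + j" "0 < j" "2 \<le> i" by auto
      with B[rule_format, of "j - 1"] show "rev es ! i = 0 \<or> rev es ! (i + 1) = 0"
        by (cases j) (auto simp: rev_nth)
    qed
  qed
  then show ?thesis
    by (simp add: N_admissible_def P_admissible_def take_rev drop_rev with_negatives_rev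
        inj_image_mem_iff)
qed

lemma t_pow_of_nat: "t_pow (int k) = replicate k gen_t"
  by (simp add: t_pow_def)

lemma t_pow_neg_of_nat: "t_pow (- int k) = replicate k gen_t_inv"
  by (simp add: t_pow_def)

lemma finite_L: "finite L1" "finite L2" "finite L3" "finite L4"
proof -
  have pm: "finite (pm n)" for n by (simp add: pm_def)
  have swap: "finite {f k es | es k. k \<in> K \<and> es \<in> A}" if "finite K" "finite A"
    for f :: "int \<Rightarrow> int list \<Rightarrow> word" and K A
    using finite_image_set2[of "\<lambda>es. es \<in> A" "\<lambda>k. k \<in> K" "\<lambda>es k. f k es"] that
    by (simp add: conj_commute)
  have listset: "finite (set_Cons B C)" if "finite B" "finite C" for B :: "int set" and C
    using finite_image_set2[of "\<lambda>x. x \<in> B" "\<lambda>xs. xs \<in> C" "(#)"] that by (simp add: set_Cons_def)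
  show "finite L1" "finite L2" "finite L3" "finite L4"
    unfolding L1_def L2_def L3_def L4_def
    by (intro finite_UnI finite_image_set finite_image_set2 swap;
        simp add: listset pm del: insert_iff)+
qed

text \<open>Each family of normal forms splits at three separators: the shorter runs are covered by a finite
  list, and the longer ones form a family of padded runs.\<close>

lemma NF2_split: "NF2 = NF2 \<inter> L1 \<union> padded_runs True 0 gen_t gen_t_inv
    {[2,0,0], [2,0,1], [2,1,0], [3,0,0], [3,0,1], [3,0,-1], [3,1,0]}" (is "_ = _ \<union> ?P")
proof -
  have "w \<in> L1 \<union> ?P" if w: "w \<in> NF2" for w
  proof -
    from w obtain k m l es where *: "w = t_pow (int k) @ N_run es @ t_pow (int m)"
      "length es = l + 1" "0 < k" "k + m \<le> l" "0 < m \<longrightarrow> last es \<noteq> 0"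
      "if 3 \<le> l then N_admissible
         {[2,0,0], [2,0,1], [2,1,0], [3,0,0], [3,0,1], [3,0,-1], [3,1,0]} es else w \<in> L1"
      unfolding NF2_def by blast
    show ?thesis
    proof (cases "3 \<le> l")
      case True
      with * have "w \<in> ?P" unfolding padded_runs_def t_pow_of_nat
        by (intro CollectI exI[of _ k] exI[of _ m] exI[of _ es]) simp
      then show ?thesis ..
    qed (use * in simp)
  qed
  moreover have "w \<in> NF2" if "w \<in> ?P" for w
  proof -
    from that obtain k m es where *: "w = replicate k gen_t @ N_run es @ replicate m gen_t"
      "0 < k" "4 \<le> length es" "k + m < length es" "0 < m \<longrightarrow> last es \<noteq> 0"
      "N_admissible {[2,0,0], [2,0,1], [2,1,0], [3,0,0], [3,0,1], [3,0,-1], [3,1,0]} es"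
      unfolding padded_runs_def by auto
    then show ?thesis unfolding NF2_def t_pow_of_nat
      by (intro CollectI exI[of _ k] exI[of _ m] exI[of _ "length es - 1"] exI[of _ es]) auto
  qed
  ultimately show ?thesis by blast
qed

lemma NF3_split: "NF3 = NF3 \<inter> L2 \<union> padded_runs False 0 gen_t gen_t_inv
    {[0,0,0], [0,0,1], [0,1,0], [1,0,0], [1,0,1], [1,0,-1], [1,1,0],
     [2,0,0], [2,0,1], [2,0,-1], [2,1,0], [3,0,0], [3,0,1], [3,0,-1], [3,1,0]}"
  (is "_ = _ \<union> padded_runs _ _ _ _ ?S")
proof -
  let ?P = "padded_runs False 0 gen_t gen_t_inv ?S"
  have "w \<in> L2 \<union> ?P" if w: "w \<in> NF3" for w
  proof -
    from w obtain m l es where *: "w = N_run es @ t_pow (int m)"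
      "length es = l + 1" "m \<le> l" "0 < m \<longrightarrow> last es \<noteq> 0"
      "if 3 \<le> l then N_admissible ?S es else w \<in> L2"
      unfolding NF3_def by blast
    show ?thesis
    proof (cases "3 \<le> l")
      case True
      with * have "w \<in> ?P" unfolding padded_runs_def t_pow_of_nat
        by (intro CollectI exI[of _ 0] exI[of _ m] exI[of _ es]) simp
      then show ?thesis ..
    qed (use * in simp)
  qed
  moreover have "w \<in> NF3" if "w \<in> ?P" for w
  proof -
    from that obtain m es where *: "w = N_run es @ replicate m gen_t"
      "4 \<le> length es" "m < length es" "0 < m \<longrightarrow> last es \<noteq> 0" "N_admissible ?S es"
      unfolding padded_runs_def by auto
    then show ?thesis unfolding NF3_def t_pow_of_nat
      by (intro CollectI exI[of _ m] exI[of _ "length es - 1"] exI[of _ es]) auto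
  qed
  ultimately show ?thesis by blast
qed

text \<open>Reversed padded runs are what the normal forms built from \<open>P\<close>-runs look like: the
  power that borders on the nonzero entry, and the nonzero entry itself, are now at the left end.\<close>

lemma in_rev_padded_runs:
  "w \<in> rev ` padded_runs b d u s (rev ` S) \<longleftrightarrow> (\<exists>k m es.
     w = replicate m u @ run s es @ replicate k u \<and> (0 < k \<longleftrightarrow> b) \<and> 4 \<le> length es \<and>
     k + m + d < length es \<and> (0 < m \<longrightarrow> hd es \<noteq> 0) \<and> P_admissible S es)" (is "_ \<longleftrightarrow> ?R w")
proof
  assume "w \<in> rev ` padded_runs b d u s (rev ` S)"
  then obtain k m es where "w = rev (replicate k u @ run s es @ replicate m u)" "0 < k \<longleftrightarrow> b"
    "4 \<le> length es" "k + m + d < length es" "0 < m \<longrightarrow> last es \<noteq> 0" "N_admissible (rev ` S) es"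
    unfolding padded_runs_def by blast
  then show "?R w"
    using N_admissible_rev[of S "rev es"]
    by (intro exI[of _ k] exI[of _ m] exI[of _ "rev es"]) (auto simp: rev_run hd_rev)
next
  assume "?R w"
  then obtain k m es where *: "w = replicate m u @ run s es @ replicate k u" "0 < k \<longleftrightarrow> b"
    "4 \<le> length es" "k + m + d < length es" "0 < m \<longrightarrow> hd es \<noteq> 0" "P_admissible S es"
    by blast
  then have "rev w \<in> padded_runs b d u s (rev ` S)"
    unfolding padded_runs_def
    by (intro CollectI exI[of _ k] exI[of _ m] exI[of _ "rev es"])
      (auto simp: rev_run last_rev N_admissible_rev)
  then show "w \<in> rev ` padded_runs b d u s (rev ` S)" by (metis imageI rev_rev_ident)
qed

text \<open>The bound for words with a \<open>P\<close>-run is strict, whence \<open>d = 1\<close>.\<close>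

lemma NF4_split: "NF4 = NF4 \<inter> L3 \<union> rev ` padded_runs False 1 gen_t_inv gen_t (rev `
    {[0,0,0], [1,0,0], [0,1,0], [0,0,1], [1,0,1], [-1,0,1], [0,1,1],
     [0,0,2], [1,0,2], [-1,0,2], [0,1,2], [0,0,3], [1,0,3], [-1,0,3], [0,1,3]})"
  (is "_ = _ \<union> rev ` padded_runs _ _ _ _ (rev ` ?S)")
proof -
  let ?P = "rev ` padded_runs False 1 gen_t_inv gen_t (rev ` ?S)"
  have "w \<in> L3 \<union> ?P" if w: "w \<in> NF4" for w
  proof -
    from w obtain m l es where *: "w = t_pow (- int m) @ P_run es"
      "length es = l + 1" "m < l" "0 < m \<longrightarrow> hd es \<noteq> 0"
      "if 3 \<le> l then P_admissible ?S es else w \<in> L3"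
      unfolding NF4_def by blast
    show ?thesis
    proof (cases "3 \<le> l")
      case True
      with * have "w \<in> ?P" unfolding in_rev_padded_runs t_pow_neg_of_nat
        by (intro exI[of _ 0] exI[of _ m] exI[of _ es]) simp
      then show ?thesis ..
    qed (use * in simp)
  qed
  moreover have "w \<in> NF4" if "w \<in> ?P" for w
  proof -
    from that obtain m es where *: "w = replicate m gen_t_inv @ P_run es"
      "4 \<le> length es" "m + 1 < length es" "0 < m \<longrightarrow> hd es \<noteq> 0" "P_admissible ?S es"
      unfolding in_rev_padded_runs by auto
    then show ?thesis unfolding NF4_def t_pow_neg_of_nat
      by (intro CollectI exI[of _ m] exI[of _ "length es - 1"] exI[of _ es]) auto
  qed
  ultimately show ?thesis by blast
qed

lemma NF5_split: "NF5 = NF5 \<inter> L4 \<union> rev ` padded_runs True 1 gen_t_inv gen_t (rev `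
    {[0,0,2], [1,0,2], [0,1,2], [0,0,3], [1,0,3], [-1,0,3], [0,1,3]})"
  (is "_ = _ \<union> rev ` padded_runs _ _ _ _ (rev ` ?S)")
proof -
  let ?P = "rev ` padded_runs True 1 gen_t_inv gen_t (rev ` ?S)"
  have "w \<in> L4 \<union> ?P" if w: "w \<in> NF5" for w
  proof -
    from w obtain m k l es where *: "w = t_pow (- int m) @ P_run es @ t_pow (- int k)"
      "length es = l + 1" "0 < k" "m + k < l" "0 < m \<longrightarrow> hd es \<noteq> 0"
      "if 3 \<le> l then P_admissible ?S es else w \<in> L4"
      unfolding NF5_def by blast
    show ?thesis
    proof (cases "3 \<le> l")
      case True
      with * have "w \<in> ?P" unfolding in_rev_padded_runs t_pow_neg_of_nat
        by (intro exI[of _ k] exI[of _ m] exI[of _ es]) simp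
      then show ?thesis ..
    qed (use * in simp)
  qed
  moreover have "w \<in> NF5" if "w \<in> ?P" for w
  proof -
    from that obtain k m es where
      *: "w = replicate m gen_t_inv @ P_run es @ replicate k gen_t_inv" "0 < k"
      "4 \<le> length es" "k + m + 1 < length es" "0 < m \<longrightarrow> hd es \<noteq> 0" "P_admissible ?S es"
      unfolding in_rev_padded_runs by auto
    then show ?thesis unfolding NF5_def t_pow_neg_of_nat
      by (intro CollectI exI[of _ m] exI[of _ k] exI[of _ "length es - 1"] exI[of _ es]) auto
  qed
  ultimately show ?thesis by blast
qed

theorem theorem5p1: "one_counter_language NF"
proof -
  have up_to_finite: "one_counter_language L"
    if "L = L \<inter> A \<union> P" "finite A" "one_counter_language P" for L A P :: "word set"
    using one_counter_language_Un[OF one_counter_language_finite[of "L \<inter> A"] that(3)] that(1,2)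
    by simp
  have "one_counter_language NF1"
    by (rule one_counter_language_finite) (simp add: NF1_def pm_def)
  moreover have "one_counter_language NF2"
    by (rule up_to_finite[OF NF2_split finite_L(1) one_counter_language_padded_runs]) simp
  moreover have "one_counter_language NF3"
    by (rule up_to_finite[OF NF3_split finite_L(2) one_counter_language_padded_runs]) simp
  moreover have "one_counter_language NF4"
    by (rule up_to_finite[OF NF4_split finite_L(3)
          one_counter_language_rev[OF one_counter_language_padded_runs]]) simp
  moreover have "one_counter_language NF5"
    by (rule up_to_finite[OF NF5_split finite_L(4)
          one_counter_language_rev[OF one_counter_language_padded_runs]]) simp
  ultimately show ?thesis unfolding NF_def by (intro one_counter_language_Un)
qed

end
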